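(* Let $T$ be any finite set of non-negative integers containing $0$ and let $r = \max T$. Let $K_{m_1,m_2,\ldots,m_k}$ be the complete $k$-partite graph with partite sets $m_1, m_2, \ldots, m_k$, where $|m_i|$ denotes the number of vertices in the $i$-th partite set. Then, with respect to $T$, $$\lambda_{t,1}(K_{m_1,m_2,\ldots,m_k}) \le rk + \sum_{i=1}^{k} |m_i| - 1.$$
   Context: $d(u,v)$ denotes the distance between vertices $u$ and $v$ of a graph. Graphs are finite, simple, connected and undirected. For a finite set $T$ of non-negative integers containing $0$, an $L(t,1)$-colouring of a graph $G$ (with respect to $T$) is an assignment $c$ of non-negative integers to the vertices of $G$ such that $|c(u)-c(v)| \notin T$ whenever $d(u,v)=1$, and $c(u) \neq c(v)$ whenever $d(u,v)=2$. The $L(t,1)$-span of $G$ (with respect to $T$) is $\lambda_{t,1}(G) = \min_c \max_{u,v \in V(G)} |c(u)-c(v)|$, the minimum being over all $L(t,1)$-colourings $c$ of $G$; equivalently, it is the minimum over all such colourings of the highest colour used. *)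

theory Defs
  imports "Graph_Theory.Graph_Theory" "HOL-Library.Disjoint_Sets"
begin

text \<open>
  As in the Graph-Theory library, a finite simple undirected graph is a symmetric digraph without
  loops and parallel arcs (locale \<^locale>\<open>graph\<close>).
\<close>

definition gdist :: "('a, 'b) pre_digraph \<Rightarrow> 'a \<Rightarrow> 'a \<Rightarrow> ereal" where
  "gdist G u v = wf_digraph.\<mu> G (\<lambda>_. 1) u v"

definition colour_diff :: "('a \<Rightarrow> nat) \<Rightarrow> 'a \<Rightarrow> 'a \<Rightarrow> nat" where
  "colour_diff c u v = nat \<bar>int (c u) - int (c v)\<bar>"

definition Lt1_colouring :: "nat set \<Rightarrow> ('a, 'b) pre_digraph \<Rightarrow> ('a \<Rightarrow> nat) \<Rightarrow> bool" where
  "Lt1_colouring T G c \<longleftrightarrow>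
     (\<forall>u \<in> verts G. \<forall>v \<in> verts G.
        (gdist G u v = 1 \<longrightarrow> colour_diff c u v \<notin> T) \<and>
        (gdist G u v = 2 \<longrightarrow> c u \<noteq> c v))"

definition colouring_span :: "('a, 'b) pre_digraph \<Rightarrow> ('a \<Rightarrow> nat) \<Rightarrow> nat" where
  "colouring_span G c = Max {colour_diff c u v | u v. u \<in> verts G \<and> v \<in> verts G}"

text \<open>
  For finite \<open>T\<close> and a nonempty graph the minimum is attained, see \<open>Lt1_span_attained\<close> below.
\<close>

definition Lt1_span :: "nat set \<Rightarrow> ('a, 'b) pre_digraph \<Rightarrow> nat" where
  "Lt1_span T G = (LEAST s. \<exists>c. Lt1_colouring T G c \<and> s = colouring_span G c)"

text \<open>
  \<open>G\<close> is the complete \<open>k\<close>-partite graph with the (nonempty, pairwise disjoint) partite sets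
  \<open>m 1, \<dots>, m k\<close>; these are finite because \<^locale>\<open>graph\<close> makes the vertex set finite.
\<close>

definition complete_multipartite :: "nat \<Rightarrow> (nat \<Rightarrow> 'a set) \<Rightarrow> ('a, 'b) pre_digraph \<Rightarrow> bool" where
  "complete_multipartite k m G \<longleftrightarrow>
     graph G \<and>
     (\<forall>i \<in> {1..k}. m i \<noteq> {}) \<and>
     disjoint_family_on m {1..k} \<and>
     verts G = (\<Union>i \<in> {1..k}. m i) \<and>
     arcs_ends G = {(u, v). \<exists>i \<in> {1..k}. \<exists>j \<in> {1..k}. i \<noteq> j \<and> u \<in> m i \<and> v \<in> m j}"

lemma (in wf_digraph) gdist_self_le: "u \<in> verts G \<Longrightarrow> gdist G u u \<le> 0"
  unfolding gdist_def using min_cost_le_walk_cost[of u "[]" u "\<lambda>_. 1"]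
  by (simp add: awalk_Nil_iff zero_ereal_def)

lemma ex_Lt1_colouring:
  assumes "finite T" "graph G"
  shows "\<exists>c. Lt1_colouring T G c"
proof -
  interpret graph G by fact
  obtain h :: "'a \<Rightarrow> nat" where h: "inj_on h (verts G)"
    using finite_imp_inj_to_nat_seg[OF finite_verts] by blast
  define r where "r = Suc (Max (insert 0 T))"
  have small: "t < r" if "t \<in> T" for t
    using that \<open>finite T\<close> by (auto simp: r_def less_Suc_eq_le)
  have far: "r \<le> colour_diff (\<lambda>v. r * h v) u v" if "h u \<noteq> h v" for u v
  proof -
    have "int r * 1 \<le> int r * \<bar>int (h u) - int (h v)\<bar>"
      using that by (intro mult_left_mono) auto
    also have "\<dots> = \<bar>int (r * h u) - int (r * h v)\<bar>"
      by (simp add: abs_mult flip: right_diff_distrib)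
    finally show ?thesis by (simp add: colour_diff_def)
  qed
  have ne: "h u \<noteq> h v" if "u \<in> verts G" "v \<in> verts G" "gdist G u v > 0" for u v
    using that h gdist_self_le[of u] by (auto simp: inj_on_eq_iff)
  have "Lt1_colouring T G (\<lambda>v. r * h v)"
    unfolding Lt1_colouring_def
  proof (intro ballI conjI impI)
    fix u v assume uv: "u \<in> verts G" "v \<in> verts G"
    { assume "gdist G u v = 1"
      with uv have "r \<le> colour_diff (\<lambda>v. r * h v) u v" by (intro far ne) auto
      then show "colour_diff (\<lambda>v. r * h v) u v \<notin> T" using small by force }
    { assume "gdist G u v = 2"
      with uv have "h u \<noteq> h v" by (intro ne) auto
      moreover have "r > 0" by (simp add: r_def)
      ultimately show "r * h u \<noteq> r * h v" by simp }
  qed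
  then show ?thesis by blast
qed

lemma Lt1_span_attained:
  assumes "finite T" "graph G"
  shows "\<exists>c. Lt1_colouring T G c \<and> Lt1_span T G = colouring_span G c"
  unfolding Lt1_span_def using ex_Lt1_colouring[OF assms]
  by (intro LeastI_ex[of "\<lambda>s. \<exists>c. Lt1_colouring T G c \<and> s = colouring_span G c"]) blast

lemma complete_multipartite_connected:
  assumes "complete_multipartite k m G" "k \<ge> 2"
  shows "Digraph_Component.connected G"
proof -
  interpret graph G using assms by (simp add: complete_multipartite_def)
  have parts: "\<And>i. i \<in> {1..k} \<Longrightarrow> m i \<noteq> {}"
    and V: "verts G = (\<Union>i \<in> {1..k}. m i)"
    and A: "\<And>u v i j. i \<in> {1..k} \<Longrightarrow> j \<in> {1..k} \<Longrightarrow> i \<noteq> j \<Longrightarrow> u \<in> m i \<Longrightarrow> v \<in> m j \<Longrightarrow> u \<rightarrow>\<^bsub>G\<^esub> v"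
    using assms(1) unfolding complete_multipartite_def by (simp, simp, blast)
  have "u \<rightarrow>\<^sup>*\<^bsub>G\<^esub> v" if "u \<in> verts G" "v \<in> verts G" for u v
  proof -
    from that V obtain i j where ij: "i \<in> {1..k}" "u \<in> m i" "j \<in> {1..k}" "v \<in> m j" by auto
    show ?thesis
    proof (cases "i = j")
      case False
      with ij show ?thesis by (intro reachable_adjI A) auto
    next
      case True
      define l where "l = (if i = 1 then 2 else 1 :: nat)"
      have l: "l \<in> {1..k}" "l \<noteq> i" using \<open>k \<ge> 2\<close> by (auto simp: l_def)
      then obtain w where w: "w \<in> m l" using parts by blast
      have "u \<rightarrow>\<^bsub>G\<^esub> w" "w \<rightarrow>\<^bsub>G\<^esub> v" using A ij w l True by metis+
      then show ?thesis by (blast intro: reachable_trans reachable_adjI)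
    qed
  qed
  moreover have "verts G \<noteq> {}" using parts[of 1] V \<open>k \<ge> 2\<close> by force
  ultimately show ?thesis
    by (auto simp: Digraph_Component.connected_def strongly_connected_def reachable_mk_symmetricI)
qed

end

theory Submission
  imports Defs
begin

text \<open>
  Give the vertices of each partite set consecutive colours, one partite set after the other, and
  leave a gap of \<open>r\<close> unused colours between consecutive sets. The colouring is injective, adjacent
  vertices receive colours differing by more than \<open>r = Max T\<close>, and the highest colour is
  \<open>r * (k - 1) + (\<Sum>i = 1..k. card (m i)) - 1\<close>.
\<close>

text \<open>\<open>gdist\<close> is an infimum of walk costs, and with unit costs a walk costs its
  length. Distance 1 forces \<open>u \<noteq> v\<close>; without an arc between them, every walk
  then has at least two arcs, so the infimum is at least 2.\<close>

lemma (in wf_digraph) gdist_eq_1_imp_dominates: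
  assumes "u \<in> verts G" "gdist G u v = 1"
  shows "u \<rightarrow>\<^bsub>G\<^esub> v"
proof (rule ccontr)
  assume na: "\<not> u \<rightarrow>\<^bsub>G\<^esub> v"
  have "u \<noteq> v"
    using gdist_self_le[of u] assms by auto
  have "2 \<le> length p" if p: "awalk u p v" for p
  proof -
    have "p \<noteq> []"
      using p \<open>u \<noteq> v\<close> by (auto simp: awalk_Nil_iff)
    moreover have "p \<noteq> [e]" for e
      using p na by (auto simp: awalk_Cons_iff awalk_Nil_iff in_arcs_imp_in_arcs_ends)
    ultimately show ?thesis
      \<comment> \<open>This rule serves only to split lists into empty, singleton and longer
        ones.\<close>
      by (cases p rule: remdups_adj.cases) auto
  qed
  then have "ereal 2 \<le> ereal (awalk_cost (\<lambda>_. 1) p)" if "awalk u p v" for p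
    using that by (fastforce simp: awalk_cost_def sum_list_triv)
  then have "ereal 2 \<le> gdist G u v"
    unfolding gdist_def \<mu>_def by (intro INF_greatest) auto
  then show False
    using assms(2) by (simp add: one_ereal_def)
qed

text \<open>Colours are natural numbers, so a difference of two colours never exceeds the larger
  one; a bound on the highest colour therefore bounds the span.\<close>

lemma Lt1_span_le:
  assumes "graph G" "verts G \<noteq> {}" "Lt1_colouring T G c" "\<And>v. v \<in> verts G \<Longrightarrow> c v \<le> b"
  shows "Lt1_span T G \<le> b"
proof -
  interpret graph G by fact
  let ?D = "{colour_diff c u v | u v. u \<in> verts G \<and> v \<in> verts G}"
  \<comment> \<open>As an image of a finite nonempty set, \<open>?D\<close> has a genuine
    maximum.\<close>
  have "?D = (\<lambda>(u, v). colour_diff c u v) ` (verts G \<times> verts G)"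
    by auto
  then have "finite ?D" "?D \<noteq> {}"
    using assms(2) by auto
  moreover have "d \<le> b" if d: "d \<in> ?D" for d
  proof -
    obtain u v where "d = colour_diff c u v" "u \<in> verts G" "v \<in> verts G"
      using d by blast
    then show ?thesis
      using assms(4)[of u] assms(4)[of v] by (simp add: colour_diff_def)
  qed
  ultimately have "colouring_span G c \<le> b"
    by (simp add: colouring_span_def)
  moreover have "Lt1_span T G \<le> colouring_span G c"
    unfolding Lt1_span_def by (rule Least_le) (use assms(3) in blast)
  ultimately show ?thesis by simp
qed

text \<open>The colouring, built without reference to a graph: the gap will serve vertices at
  distance 1, injectivity those at distance 2, and the last property bounds the span.\<close>

lemma colour_classes_in_blocks:
  fixes m :: "nat \<Rightarrow> 'a set" and r k :: nat
  assumes fin: "\<And>i. i \<in> {1..k} \<Longrightarrow> finite (m i)"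
    and disj: "disjoint_family_on m {1..k}"
  obtains c :: "'a \<Rightarrow> nat" where
    "inj_on c (\<Union>i\<in>{1..k}. m i)"
    "\<And>i j u v. i \<in> {1..k} \<Longrightarrow> j \<in> {1..k} \<Longrightarrow> i < j \<Longrightarrow> u \<in> m i \<Longrightarrow> v \<in> m j \<Longrightarrow> c u + r < c v"
    "\<And>v. v \<in> (\<Union>i\<in>{1..k}. m i) \<Longrightarrow> c v < r * k + (\<Sum>i = 1..k. card (m i))"
proof -
  have "\<exists>h. bij_betw h (m i) {0..<card (m i)}" if "i \<in> {1..k}" for i
    using ex_bij_betw_finite_nat fin that by blast
  then obtain h where h: "\<And>i. i \<in> {1..k} \<Longrightarrow> bij_betw (h i) (m i) {0..<card (m i)}"
    by metis
  define part where "part v = (THE i. i \<in> {1..k} \<and> v \<in> m i)" for v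
  have part: "part v = i" if "i \<in> {1..k}" "v \<in> m i" for v i
    unfolding part_def using that disj by (intro the_equality) (auto dest: disjoint_family_onD)
  \<comment> \<open>First colour of block \<open>i\<close>. Blocks are numbered from 1, so
    \<open>base 1 = r\<close>: the whole colouring is shifted up by \<open>r\<close>, which the term
    \<open>r * k\<close> of the bound still allows.\<close>
  define base where "base i = r * i + (\<Sum>j\<in>{1..<i}. card (m j))" for i
  define c where "c v = base (part v) + h (part v) v" for v
  have c: "c v = base i + h i v" "h i v < card (m i)" if "i \<in> {1..k}" "v \<in> m i" for v i
    using part[OF that] h[OF that(1)] that(2) by (auto simp: c_def bij_betw_def)
  have base_Suc: "base (Suc i) = base i + card (m i) + r" if "i \<ge> 1" for i
    using that by (simp add: base_def)
  have base_mono: "base i \<le> base j" if "i \<le> j" for i j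
    unfolding base_def using that by (intro add_mono sum_mono2 mult_left_mono) auto
  have gap: "c u + r < c v"
    if "i \<in> {1..k}" "j \<in> {1..k}" "i < j" "u \<in> m i" "v \<in> m j" for i j u v
  proof -
    have "c u + r < base (Suc i)"
      using c[of i u] base_Suc[of i] that by simp
    also have "\<dots> \<le> base j"
      using that by (intro base_mono) simp
    also have "\<dots> \<le> c v"
      using c[of j v] that by simp
    finally show ?thesis .
  qed
  show thesis
  proof
    show "inj_on c (\<Union>i\<in>{1..k}. m i)"
    proof (rule inj_onI)
      fix u v assume "u \<in> (\<Union>i\<in>{1..k}. m i)" "v \<in> (\<Union>i\<in>{1..k}. m i)" and eq: "c u = c v"
      then obtain i j where ij: "i \<in> {1..k}" "u \<in> m i" "j \<in> {1..k}" "v \<in> m j"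
        by blast
      have "i = j"
        using gap[of i j u v] gap[of j i v u] ij eq by (cases i j rule: linorder_cases) auto
      with ij eq have "h i u = h i v"
        using c[of i u] c[of i v] by simp
      then show "u = v"
        using h[OF ij(1)] ij \<open>i = j\<close> by (auto simp: bij_betw_def inj_on_eq_iff)
    qed
  next
    fix v assume "v \<in> (\<Union>i\<in>{1..k}. m i)"
    then obtain i where i: "i \<in> {1..k}" "v \<in> m i" by blast
    \<comment> \<open>\<open>base (Suc k)\<close> is where a further block would start; dropping the
      gap of \<open>r\<close> before it turns \<open>r * Suc k\<close> into
      \<open>r * k\<close>.\<close>
    have "c v + r < base (Suc i)"
      using c[OF i] base_Suc[of i] i by simp
    also have "\<dots> \<le> base (Suc k)"
      using i by (intro base_mono) simp
    finally show "c v < r * k + (\<Sum>i = 1..k. card (m i))"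
      by (simp add: base_def atLeastLessThanSuc_atLeastAtMost)
  qed (fact gap)
qed

theorem theorem2p4:
  fixes T :: "nat set" and k :: nat and m :: "nat \<Rightarrow> 'a set" and G :: "('a, 'b) pre_digraph"
  assumes "finite T" and "0 \<in> T"
    and "complete_multipartite k m G"
    and "Digraph_Component.connected G"
  shows "int (Lt1_span T G) \<le> int (Max T) * int k + (\<Sum>i = 1..k. int (card (m i))) - 1"
proof -
  interpret graph G using assms(3) by (simp add: complete_multipartite_def)
  have disj: "disjoint_family_on m {1..k}"
    and V: "verts G = (\<Union>i \<in> {1..k}. m i)"
    and A: "arcs_ends G = {(u, v). \<exists>i \<in> {1..k}. \<exists>j \<in> {1..k}. i \<noteq> j \<and> u \<in> m i \<and> v \<in> m j}"
    using assms(3) unfolding complete_multipartite_def by simp_all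
  have fin: "finite (m i)" if "i \<in> {1..k}" for i
    using finite_verts that unfolding V by (blast intro: finite_subset)
  \<comment> \<open>Connectedness includes nonemptiness, which excludes \<open>k = 0\<close>, where
    the claimed bound would be -1.\<close>
  have ne: "verts G \<noteq> {}"
    using assms(4) by (auto simp: Digraph_Component.connected_def strongly_connected_def)
  define N where "N = Max T * k + (\<Sum>i = 1..k. card (m i))"
  obtain c where inj: "inj_on c (verts G)"
    and gap: "\<And>i j u v. i \<in> {1..k} \<Longrightarrow> j \<in> {1..k} \<Longrightarrow> i < j \<Longrightarrow> u \<in> m i \<Longrightarrow> v \<in> m j
                \<Longrightarrow> c u + Max T < c v"
    and bound: "\<And>v. v \<in> verts G \<Longrightarrow> c v < N"
    using colour_classes_in_blocks[of k m "Max T", OF fin disj] unfolding V N_def by blast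
  have "Lt1_colouring T G c"
    unfolding Lt1_colouring_def
  proof (intro ballI conjI impI)
    fix u v assume uv: "u \<in> verts G" "v \<in> verts G"
    { assume "gdist G u v = 1"
      then have "u \<rightarrow>\<^bsub>G\<^esub> v"
        using uv gdist_eq_1_imp_dominates by blast
      then obtain i j where ij: "i \<in> {1..k}" "j \<in> {1..k}" "i \<noteq> j" "u \<in> m i" "v \<in> m j"
        unfolding A by blast
      then have "Max T < colour_diff c u v"
        using gap[of i j u v] gap[of j i v u]
        by (cases i j rule: linorder_cases) (auto simp: colour_diff_def)
      then show "colour_diff c u v \<notin> T"
        using Max_ge[OF \<open>finite T\<close>] by (meson leD) }
    { assume "gdist G u v = 2"
      \<comment> \<open>For an injective colouring, distance 2 only has to guarantee distinct
        vertices.\<close>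
      then have "u \<noteq> v"
        using gdist_self_le[OF uv(1)] by auto
      then show "c u \<noteq> c v"
        using inj uv by (simp add: inj_on_eq_iff) }
  qed
  moreover have "c v \<le> N - 1" if "v \<in> verts G" for v
    using bound[OF that] by simp
  ultimately have "Lt1_span T G \<le> N - 1"
    using ne by (intro Lt1_span_le[of _ _ c]) unfold_locales
  \<comment> \<open>Positivity makes the truncated \<open>N - 1\<close> agree with the integer
    subtraction in the claim.\<close>
  moreover have "N > 0"
    using ne bound by fastforce
  ultimately have "int (Lt1_span T G) \<le> int N - 1"
    by simp
  then show ?thesis
    by (simp add: N_def)
qed

end
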